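(* Let Assumption 1 (recalled in the context) hold. Let $\mu=(\mu_1,\dots,\mu_N)\in\mathcal{P}_\delta$, let $X_1,\dots,X_N$ be independent random variables with $X_i\sim\mu_i$, and let $X=(X_1,\dots,X_N)$. Then, for all $\epsilon>0$, $$\mathbb{P}\Big[J(X)<\mathcal{J}(\mu)+\frac{C_1}{2N}+\epsilon\Big]\ \ge\ 1-\exp\Big(-\frac{2N\epsilon^2}{C_0^2}\Big).$$ Assume further that for all $i=1,\dots,N$ there exists a constant $v_i$ such that $\sigma^2_{\mu_i}\big[J(\cdot,x_{-i})\big]\le v_i^2$ for all $x_{-i}\in\mathcal{X}_{-i}$. Then, for all $\epsilon>0$, $$\mathbb{P}\Big[J(X)<\mathcal{J}(\mu)+\sum_{j=1}^M\sum_{i=1}^N\frac{\tilde L_j}{2N^2}\sigma^2_{\mu_i}[g_{ij}]+\epsilon\Big]\ \ge\ 1-\exp\left(-\frac{N\epsilon^2}{2\big(\sum_{i=1}^NNv_i^2+\frac{C_0\epsilon}{3}\big)}\right).$$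
   Context: Setting. $N,M\ge1$ are integers; $\mathcal{X}_1,\dots,\mathcal{X}_N$ are nonempty sets and $\mathcal{X}=\prod_{i=1}^N\mathcal{X}_i$; $\mathcal{X}_{-i}=\prod_{i'\ne i}\mathcal{X}_{i'}$, and $x\in\mathcal{X}$ is also written $(x_i,x_{-i})$. $\mathcal{E}_1,\dots,\mathcal{E}_M$ are separable real Hilbert spaces and $\mathcal{E}=\prod_{j=1}^M\mathcal{E}_j$ with scalar product $\langle y,y'\rangle=\sum_j\langle y_j,y_j'\rangle_{\mathcal{E}_j}$. For each $i,j$ we are given maps $g_{ij}:\mathcal{X}_i\to\mathcal{E}_j$ and $f_j:\mathcal{E}_j\to\mathbb{R}$; $g_i=(g_{ij})_{j=1,\dots,M}$ and $f(y)=\sum_{j=1}^M f_j(y_j)$. The cost is $J(x)=f\big(\frac1N\sum_{i=1}^N g_i(x_i)\big)$ for $x\in\mathcal{X}$. Randomized cost. For a set $\Omega$, $\mathcal{P}_\delta(\Omega)$ is the set of finitely supported probability measures $\sum_{k=1}^K\lambda_k\delta_{x_k}$ on $\Omega$. For $\mu=\sum_k\lambda_k\delta_{x_k}\in\mathcal{P}_\delta(\Omega)$ and $F:\Omega\to\mathcal{H}$ with $\mathcal{H}$ a Hilbert space, $E_\mu[F]=\sum_k\lambda_kF(x_k)$ and $\sigma_\mu^2[F]=\sum_k\lambda_k\|F(x_k)-E_\mu[F]\|_{\mathcal{H}}^2$. Put $\mathcal{P}_\delta=\prod_{i=1}^N\mathcal{P}_\delta(\mathcal{X}_i)$ and $\mathcal{J}(\mu)=f\big(\frac1N\sum_{i=1}^NE_{\mu_i}[g_i]\big)$.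 Assumption 1. Let $S_{ij}=g_{ij}(\mathcal{X}_i)$ and $S_j=\frac1N\sum_{i=1}^NS_{ij}$ (Minkowski sum). For all $i,j$: (1) $S_{ij}$ has finite diameter $d_{ij}$; (2) $f_j$ is $L_j$-Lipschitz on $\mathrm{conv}(S_j)$; (3) $f_j$ is continuously differentiable on a neighborhood of $\mathrm{conv}(S_j)$ and $\nabla f_j$ is $\tilde L_j$-Lipschitz on $\mathrm{conv}(S_j)$. Constants (taken positive): $C_0=\sum_{j=1}^M\big(L_j\max_{1\le i\le N}d_{ij}\big)>0$ and $C_1=\frac1N\sum_{j=1}^M\big(\tilde L_j\sum_{i=1}^Nd_{ij}^2\big)>0$. *)

theory Defs
  imports "HOL-Probability.Probability" "HOL-Library.Set_Algebras"
begin

text \<open>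
  The separable Hilbert spaces \<open>E 1, \<dots>, E M\<close> are closed subspaces of one ambient separable Hilbert
  space \<open>'e\<close>. No generality is lost, because finitely many separable Hilbert spaces embed
  isometrically into their direct sum. Likewise the strategy sets \<open>\<X> 1, \<dots>, \<X> N\<close> are arbitrary
  subsets of one type \<open>'a\<close>. A point of the product of the \<open>E j\<close> is a function of \<open>j\<close>, and the
  values of \<open>g i j\<close> off \<open>\<X> i\<close> and of \<open>f j\<close> off \<open>E j\<close> are irrelevant.
\<close>

definition separable_cost :: "nat \<Rightarrow> (nat \<Rightarrow> 'e \<Rightarrow> real) \<Rightarrow> (nat \<Rightarrow> 'e) \<Rightarrow> real" where
  "separable_cost M f y = (\<Sum>j=1..M. f j (y j))"

definition J_cost ::
    "nat \<Rightarrow> nat \<Rightarrow> (nat \<Rightarrow> 'e::real_vector \<Rightarrow> real) \<Rightarrow> (nat \<Rightarrow> nat \<Rightarrow> 'a \<Rightarrow> 'e) \<Rightarrow> (nat \<Rightarrow> 'a) \<Rightarrow> real" where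
  "J_cost N M f g x = separable_cost M f (\<lambda>j. (1 / real N) *\<^sub>R (\<Sum>i=1..N. g i j (x i)))"

definition finsupp_pmfs :: "'a set \<Rightarrow> 'a pmf set" where
  "finsupp_pmfs \<Omega> = {p. finite (set_pmf p) \<and> set_pmf p \<subseteq> \<Omega>}"

definition pmf_mean :: "'a pmf \<Rightarrow> ('a \<Rightarrow> 'h::real_inner) \<Rightarrow> 'h" where
  "pmf_mean p F = (\<Sum>x\<in>set_pmf p. pmf p x *\<^sub>R F x)"

definition pmf_var :: "'a pmf \<Rightarrow> ('a \<Rightarrow> 'h::real_inner) \<Rightarrow> real" where
  "pmf_var p F = (\<Sum>x\<in>set_pmf p. pmf p x * (norm (F x - pmf_mean p F))\<^sup>2)"

lemma pmf_mean_eq_expectation: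
  fixes F :: "'a \<Rightarrow> 'h::{real_inner, banach, second_countable_topology}"
  assumes "finite (set_pmf p)"
  shows "pmf_mean p F = measure_pmf.expectation p F"
  unfolding pmf_mean_def by (rule integral_measure_pmf[OF assms, symmetric]) auto

lemma pmf_var_eq_expectation:
  fixes F :: "'a \<Rightarrow> 'h::real_inner"
  assumes "finite (set_pmf p)"
  shows "pmf_var p F = measure_pmf.expectation p (\<lambda>x. (norm (F x - pmf_mean p F))\<^sup>2)"
  unfolding pmf_var_def
  by (subst integral_measure_pmf[OF assms]) auto

definition rand_cost ::
    "nat \<Rightarrow> nat \<Rightarrow> (nat \<Rightarrow> 'e::real_inner \<Rightarrow> real) \<Rightarrow> (nat \<Rightarrow> nat \<Rightarrow> 'a \<Rightarrow> 'e) \<Rightarrow> (nat \<Rightarrow> 'a pmf) \<Rightarrow> real" where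
  "rand_cost N M f g \<mu> =
     separable_cost M f (\<lambda>j. (1 / real N) *\<^sub>R (\<Sum>i=1..N. pmf_mean (\<mu> i) (g i j)))"

text \<open>The sum of sets below is the Minkowski sum of \<^theory>\<open>HOL-Library.Set_Algebras\<close>.\<close>

definition aggregate_set ::
    "nat \<Rightarrow> (nat \<Rightarrow> 'a set) \<Rightarrow> (nat \<Rightarrow> nat \<Rightarrow> 'a \<Rightarrow> 'e::real_vector) \<Rightarrow> nat \<Rightarrow> 'e set" where
  "aggregate_set N \<X> g j = (\<lambda>y. (1 / real N) *\<^sub>R y) ` (\<Sum>i\<in>{1..N}. g i j ` \<X> i)"

text \<open>
  \<open>G\<close> is the gradient of \<open>\<phi>\<close> on \<open>U\<close> relative to the Hilbert space \<open>E\<close>. When \<open>U\<close> is open in \<open>E\<close>,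
  the requirement \<open>G y \<in> E\<close> makes it unique on \<open>U\<close>.
\<close>

definition has_gradient_on ::
    "('e::real_inner \<Rightarrow> real) \<Rightarrow> ('e \<Rightarrow> 'e) \<Rightarrow> 'e set \<Rightarrow> 'e set \<Rightarrow> bool" where
  "has_gradient_on \<phi> G E U \<longleftrightarrow>
     (\<forall>y\<in>U. G y \<in> E \<and> (\<phi> has_derivative (\<lambda>h. inner (G y) h)) (at y within E))"

definition cost_regularity ::
    "nat \<Rightarrow> nat \<Rightarrow> (nat \<Rightarrow> 'a set) \<Rightarrow> (nat \<Rightarrow> 'e::real_inner set) \<Rightarrow> (nat \<Rightarrow> 'e \<Rightarrow> real) \<Rightarrow>
     (nat \<Rightarrow> nat \<Rightarrow> 'a \<Rightarrow> 'e) \<Rightarrow> (nat \<Rightarrow> real) \<Rightarrow> (nat \<Rightarrow> real) \<Rightarrow> bool" where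
  "cost_regularity N M \<X> E f g L L' \<longleftrightarrow>
     (\<forall>j\<in>{1..M}.
        (\<forall>i\<in>{1..N}. bounded (g i j ` \<X> i)) \<and>
        (L j)-lipschitz_on (convex hull (aggregate_set N \<X> g j)) (f j) \<and>
        (\<exists>U G. openin (top_of_set (E j)) U \<and> convex hull (aggregate_set N \<X> g j) \<subseteq> U \<and>
               has_gradient_on (f j) G (E j) U \<and> continuous_on U G \<and>
               (L' j)-lipschitz_on (convex hull (aggregate_set N \<X> g j)) G))"

definition C0_const ::
    "nat \<Rightarrow> nat \<Rightarrow> (nat \<Rightarrow> 'a set) \<Rightarrow> (nat \<Rightarrow> nat \<Rightarrow> 'a \<Rightarrow> 'e::metric_space) \<Rightarrow> (nat \<Rightarrow> real) \<Rightarrow> real" where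
  "C0_const N M \<X> g L = (\<Sum>j=1..M. L j * Max ((\<lambda>i. diameter (g i j ` \<X> i)) ` {1..N}))"

definition C1_const ::
    "nat \<Rightarrow> nat \<Rightarrow> (nat \<Rightarrow> 'a set) \<Rightarrow> (nat \<Rightarrow> nat \<Rightarrow> 'a \<Rightarrow> 'e::metric_space) \<Rightarrow> (nat \<Rightarrow> real) \<Rightarrow> real" where
  "C1_const N M \<X> g L' =
     1 / real N * (\<Sum>j=1..M. L' j * (\<Sum>i=1..N. (diameter (g i j ` \<X> i))\<^sup>2))"

end

theory Submission
  imports Defs
begin

text \<open>
  On a convex set the quadratic upper bound for a function with Lipschitz gradient, taken at the
  mean aggregate and averaged over the product of the \<open>\<mu> i\<close>, bounds the expectation of \<open>J(X)\<close>: the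
  first-order term vanishes, and by independence the second moment is the sum of the variances
  divided by \<open>N\<^sup>2\<close>. Changing one coordinate moves \<open>J\<close> by at most \<open>C\<^sub>0 / N\<close>, so the deviation of
  \<open>J(X)\<close> from its expectation is controlled by McDiarmid's inequality and by its Bernstein
  version. Both are Chernoff bounds in which the moment generating function factorises over the
  coordinates: average out the coordinates one by one and use that bounds on oscillation and on
  variance survive averaging over the remaining coordinates.
\<close>

subsection \<open>Concentration for finitely supported product measures\<close>

lemma expectation_mono_finite:
  fixes f g :: "'a \<Rightarrow> real"
  assumes "finite (set_pmf p)" "\<And>x. x \<in> set_pmf p \<Longrightarrow> f x \<le> g x"
  shows "measure_pmf.expectation p f \<le> measure_pmf.expectation p g"
  using assms
  by (intro integral_mono_AE integrable_measure_pmf_finite) (auto simp: AE_measure_pmf_iff)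

lemma expectation_finite_sum:
  fixes f :: "'a \<Rightarrow> 'b::{banach, second_countable_topology}"
  assumes "finite (set_pmf p)"
  shows "measure_pmf.expectation p f = (\<Sum>x\<in>set_pmf p. pmf p x *\<^sub>R f x)"
  using assms by (rule integral_measure_pmf) auto

lemma expectation_swap_finite:
  fixes f :: "'a \<Rightarrow> 'b \<Rightarrow> 'c::{banach, second_countable_topology}"
  assumes "finite (set_pmf p)" "finite (set_pmf q)"
  shows "measure_pmf.expectation p (\<lambda>x. measure_pmf.expectation q (f x)) =
         measure_pmf.expectation q (\<lambda>y. measure_pmf.expectation p (\<lambda>x. f x y))"
  unfolding expectation_finite_sum[OF assms(1)] expectation_finite_sum[OF assms(2)]
  by (simp add: scaleR_sum_right sum.swap[of _ "set_pmf q"] mult.commute)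

lemma finite_set_Pi_pmf:
  assumes "finite I" "\<And>i. i \<in> I \<Longrightarrow> finite (set_pmf (p i))"
  shows "finite (set_pmf (Pi_pmf I d p))"
  using assms by (auto simp: set_Pi_pmf)

text \<open>Fubini in the form that drives the inductions over coordinates: coordinate
  \<open>i\<close> is drawn in the outer expectation, and the remaining ones are averaged with
  \<open>i\<close> frozen at \<open>z\<close>.\<close>

lemma expectation_Pi_pmf_insert:
  fixes F :: "('i \<Rightarrow> 'a) \<Rightarrow> 'b::{banach, second_countable_topology}"
  assumes "finite I" "i \<notin> I" "\<And>k. k \<in> insert i I \<Longrightarrow> finite (set_pmf (p k))"
  shows "measure_pmf.expectation (Pi_pmf (insert i I) d p) F =
         measure_pmf.expectation (p i) (\<lambda>z. measure_pmf.expectation (Pi_pmf I d p) (\<lambda>x. F (x(i := z))))"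
proof -
  have fin: "finite (set_pmf (Pi_pmf I d p))" "finite (set_pmf (p i))"
    using assms by (auto intro!: finite_set_Pi_pmf)
  have "Pi_pmf (insert i I) d p = p i \<bind> (\<lambda>z. map_pmf (\<lambda>x. x(i := z)) (Pi_pmf I d p))"
    using assms by (simp add: Pi_pmf_insert' map_pmf_def)
  then show ?thesis
    using fin by (simp add: pmf_expectation_bind[of "set_pmf (p i)"] expectation_finite_sum[OF fin(2)])
qed

text \<open>
  \<open>Q i\<close> is a condition on functions of the \<open>i\<close>-th coordinate alone. Stability of \<open>Q i\<close> under
  averaging replaces the conditional expectations of the martingale method.
\<close>

lemma mgf_Pi_pmf_le:
  fixes p :: "'i \<Rightarrow> 'a pmf" and F :: "('i \<Rightarrow> 'a) \<Rightarrow> real"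
  assumes "finite I" and "\<And>i. i \<in> I \<Longrightarrow> finite (set_pmf (p i))"
    and "\<And>i (q :: ('i \<Rightarrow> 'a) pmf) u. i \<in> I \<Longrightarrow> finite (set_pmf q) \<Longrightarrow> (\<And>x. x \<in> set_pmf q \<Longrightarrow> Q i (u x))
           \<Longrightarrow> Q i (\<lambda>z. measure_pmf.expectation q (\<lambda>x. u x z))"
    and "\<And>i u. i \<in> I \<Longrightarrow> Q i u \<Longrightarrow>
           measure_pmf.expectation (p i) (\<lambda>z. exp (s * (u z - measure_pmf.expectation (p i) u))) \<le> K i"
    and "\<And>i. i \<in> I \<Longrightarrow> 0 \<le> K i"
    and "\<And>i x. i \<in> I \<Longrightarrow> x \<in> PiE_dflt (I - {i}) d (set_pmf \<circ> p) \<Longrightarrow> Q i (\<lambda>z. F (x(i := z)))"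
  shows "measure_pmf.expectation (Pi_pmf I d p)
           (\<lambda>x. exp (s * (F x - measure_pmf.expectation (Pi_pmf I d p) F))) \<le> (\<Prod>i\<in>I. K i)"
  using assms
proof (induction I arbitrary: F rule: finite_induct)
  case empty
  then show ?case by simp
next
  case (insert i I)
  let ?PI = "Pi_pmf I d p"
  \<comment> \<open>\<open>h z\<close> is the conditional mean of \<open>F\<close> given that
    coordinate \<open>i\<close> equals \<open>z\<close>. The deviation \<open>F - e\<close> splits
    into \<open>F - h z\<close>, handled by the induction hypothesis for each \<open>z\<close>, and
    \<open>h z - e\<close>, a centred function of coordinate \<open>i\<close> alone.\<close>
  define h where "h z = measure_pmf.expectation ?PI (\<lambda>x. F (x(i := z)))" for z
  define e where "e = measure_pmf.expectation (p i) h"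
  have fin: "finite (set_pmf ?PI)" "finite (set_pmf (p i))"
    using insert by (auto intro!: finite_set_Pi_pmf)
  have expand: "measure_pmf.expectation (Pi_pmf (insert i I) d p) G =
      measure_pmf.expectation (p i) (\<lambda>z. measure_pmf.expectation ?PI (\<lambda>x. G (x(i := z))))"
    for G :: "('i \<Rightarrow> 'a) \<Rightarrow> real"
    using insert by (intro expectation_Pi_pmf_insert) auto
  have EF: "measure_pmf.expectation (Pi_pmf (insert i I) d p) F = e"
    unfolding e_def h_def by (rule expand)
  have IH: "measure_pmf.expectation ?PI (\<lambda>x. exp (s * (F (x(i := z)) - h z))) \<le> (\<Prod>i\<in>I. K i)"
    if z: "z \<in> set_pmf (p i)" for z
    unfolding h_def
  proof (rule insert.IH)
    fix k x assume k: "k \<in> I" and x: "x \<in> PiE_dflt (I - {k}) d (set_pmf \<circ> p)"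
    from k insert.hyps have ki: "k \<noteq> i" by auto
    \<comment> \<open>Since \<open>z\<close> lies in the support of \<open>p i\<close>, the point
      \<open>x(i := z)\<close> is again admissible for the larger index set. As \<open>k\<close>
      differs from \<open>i\<close>, the two updates commute.\<close>
    have "Q k (\<lambda>y. F ((x(i := z))(k := y)))"
      using k x z insert.hyps by (intro insert.prems) (auto simp: PiE_dflt_def)
    with ki show "Q k (\<lambda>y. F (x(k := y, i := z)))" by (simp add: fun_upd_twist)
  qed (use insert.prems in auto)
  have Qh: "Q i h"
    unfolding h_def
  proof (rule insert.prems(2))
    fix x assume "x \<in> set_pmf ?PI"
    then show "Q i (\<lambda>z. F (x(i := z)))"
      using insert.hyps by (intro insert.prems) (auto simp: set_Pi_pmf comp_def)
  qed (use fin in auto)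
  have K0: "0 \<le> (\<Prod>i\<in>I. K i)" using insert.prems by (auto intro!: prod_nonneg)
  \<comment> \<open>The exponential of the split deviation is a product, and its factor depending on
    \<open>z\<close> alone leaves the inner expectation.\<close>
  have "measure_pmf.expectation (Pi_pmf (insert i I) d p) (\<lambda>x. exp (s * (F x - e)))
      = measure_pmf.expectation (p i) (\<lambda>z. exp (s * (h z - e)) *
          measure_pmf.expectation ?PI (\<lambda>x. exp (s * (F (x(i := z)) - h z))))"
    unfolding expand
    by (subst integral_mult_right_zero[symmetric]) (simp add: exp_add[symmetric] algebra_simps)
  also have "\<dots> \<le> measure_pmf.expectation (p i) (\<lambda>z. exp (s * (h z - e)) * (\<Prod>i\<in>I. K i))"
    using fin IH by (intro expectation_mono_finite mult_left_mono) auto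
  also have "\<dots> = measure_pmf.expectation (p i) (\<lambda>z. exp (s * (h z - e))) * (\<Prod>i\<in>I. K i)"
    by simp
  also have "\<dots> \<le> K i * (\<Prod>i\<in>I. K i)"
    unfolding e_def using insert.prems(3)[OF _ Qh] K0 by (intro mult_right_mono) auto
  finally show ?case
    using insert.hyps by (simp add: EF)
qed

section \<open>Oscillation and variance bounds survive averaging\<close>

definition oscillation_le :: "'a pmf \<Rightarrow> real \<Rightarrow> ('a \<Rightarrow> real) \<Rightarrow> bool" where
  "oscillation_le p c u \<longleftrightarrow> (\<forall>z\<in>set_pmf p. \<forall>z'\<in>set_pmf p. u z - u z' \<le> c)"

lemma oscillation_le_expectation:
  assumes "finite (set_pmf q)" "\<And>x. x \<in> set_pmf q \<Longrightarrow> oscillation_le p c (u x)"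
  shows "oscillation_le p c (\<lambda>z. measure_pmf.expectation q (\<lambda>x. u x z))"
  unfolding oscillation_le_def
proof (intro ballI)
  fix z z' assume "z \<in> set_pmf p" "z' \<in> set_pmf p"
  then have "measure_pmf.expectation q (\<lambda>x. u x z) \<le> measure_pmf.expectation q (\<lambda>x. u x z' + c)"
    using assms unfolding oscillation_le_def by (intro expectation_mono_finite) (auto simp: algebra_simps)
  also have "\<dots> = measure_pmf.expectation q (\<lambda>x. u x z') + c"
    using assms by (subst Bochner_Integration.integral_add) (auto intro: integrable_measure_pmf_finite)
  finally show "measure_pmf.expectation q (\<lambda>x. u x z) - measure_pmf.expectation q (\<lambda>x. u x z') \<le> c"
    by simp
qed

lemma square_expectation_le:
  fixes f :: "'a \<Rightarrow> real"
  assumes "finite (set_pmf p)"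
  shows "(measure_pmf.expectation p f)\<^sup>2 \<le> measure_pmf.expectation p (\<lambda>x. (f x)\<^sup>2)"
  using measure_pmf.variance_eq[of p f] measure_pmf.variance_positive[of p f] assms
  by (auto simp: integrable_measure_pmf_finite)

text \<open>Variance is convex: centre each \<open>u x\<close> at its own mean \<open>?m x\<close>,
  bound the square of the average over \<open>q\<close> by the average of the squares, and exchange
  the two expectations.\<close>

lemma variance_expectation_le:
  fixes u :: "'b \<Rightarrow> 'a \<Rightarrow> real"
  assumes p: "finite (set_pmf p)" and q: "finite (set_pmf q)"
    and var: "\<And>x. x \<in> set_pmf q \<Longrightarrow> measure_pmf.variance p (u x) \<le> w"
  shows "measure_pmf.variance p (\<lambda>z. measure_pmf.expectation q (\<lambda>x. u x z)) \<le> w"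
proof -
  note [simp] = integrable_measure_pmf_finite[OF p] integrable_measure_pmf_finite[OF q]
  let ?m = "\<lambda>x. measure_pmf.expectation p (u x)"
  have "measure_pmf.variance p (\<lambda>z. measure_pmf.expectation q (\<lambda>x. u x z))
      = measure_pmf.expectation p (\<lambda>z. (measure_pmf.expectation q (\<lambda>x. u x z - ?m x))\<^sup>2)"
    by (simp add: expectation_swap_finite[OF p q])
  also have "\<dots> \<le> measure_pmf.expectation p (\<lambda>z. measure_pmf.expectation q (\<lambda>x. (u x z - ?m x)\<^sup>2))"
    by (intro expectation_mono_finite p q square_expectation_le)
  also have "\<dots> = measure_pmf.expectation q (\<lambda>x. measure_pmf.variance p (u x))"
    by (rule expectation_swap_finite[OF p q])
  also have "\<dots> \<le> measure_pmf.expectation q (\<lambda>x. w)"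
    by (intro expectation_mono_finite q var)
  finally show ?thesis by simp
qed

section \<open>Moment generating functions in one coordinate\<close>

lemma mgf_oscillation_le:
  fixes u :: "'a \<Rightarrow> real"
  assumes fin: "finite (set_pmf p)" and osc: "oscillation_le p c u" and "s > 0"
  shows "measure_pmf.expectation p (\<lambda>z. exp (s * (u z - measure_pmf.expectation p u))) \<le> exp (s\<^sup>2 * c\<^sup>2 / 8)"
proof -
  \<comment> \<open>The minimum over the support is attained, so the oscillation bound places
    \<open>u\<close> in an interval of length \<open>c\<close> starting at \<open>a\<close>.
    Hoeffding's lemma on this interval gives the constant 1/8.\<close>
  define a where "a = Min (u ` set_pmf p)"
  have a_le: "a \<le> u z" if "z \<in> set_pmf p" for z
    unfolding a_def using fin that by auto
  have "a \<in> u ` set_pmf p"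
    unfolding a_def using fin by (intro Min_in) (auto simp: set_pmf_not_empty)
  then have le: "u z \<le> a + c" if "z \<in> set_pmf p" for z
    using osc that by (force simp: oscillation_le_def algebra_simps)
  interpret interval_bounded_random_variable p u a "a + c"
    by unfold_locales (auto simp: AE_measure_pmf_iff a_le le)
  have "ennreal (measure_pmf.expectation p (\<lambda>z. exp (s * (u z - measure_pmf.expectation p u))))
     = (\<integral>\<^sup>+z. exp (s * (u z - measure_pmf.expectation p u)) \<partial>p)"
    using fin by (intro nn_integral_eq_integral[symmetric] integrable_measure_pmf_finite) auto
  also have "\<dots> \<le> ennreal (exp (s\<^sup>2 * c\<^sup>2 / 8))"
    using Hoeffdings_lemma_nn_integral[OF \<open>s > 0\<close>] by simp
  finally show ?thesis by simp
qed

text \<open>Lets a geometric series of ratio \<open>x / 3\<close> dominate the exponential series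
  from its quadratic term on; this is the source of the 3 in Bernstein's bound.\<close>

lemma two_power3_le_fact: "2 * 3 ^ k \<le> (fact (k + 2) :: real)"
proof (induction k)
  case (Suc k)
  have "2 * 3 ^ Suc k \<le> 3 * (fact (k + 2) :: real)" using Suc unfolding power_Suc by linarith
  also have "\<dots> \<le> (real k + 3) * fact (k + 2)" by (intro mult_right_mono) auto
  also have "\<dots> = fact (Suc k + 2)" by (simp add: algebra_simps)
  finally show ?case .
qed (simp add: fact_numeral)

text \<open>For nonnegative \<open>x\<close>, the exponential series without its first two terms is
  compared termwise with a geometric series, and then \<open>x\<close> is replaced by
  \<open>b\<close> in the denominator. For negative \<open>x\<close>, the cubic Taylor remainder is
  nonpositive, so the quadratic term alone suffices.\<close>

lemma exp_minus_linear_le: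
  fixes x b :: real
  assumes "x \<le> b" "0 \<le> b" "b < 3"
  shows "exp x \<le> 1 + x + x\<^sup>2 / (2 * (1 - b / 3))"
proof (cases "x \<ge> 0")
  case True
  have geo: "(\<lambda>k. x\<^sup>2 / 2 * (x / 3) ^ k) sums (x\<^sup>2 / 2 * (1 / (1 - x / 3)))"
    using True assms by (intro sums_mult geometric_sums) auto
  have ex: "(\<lambda>k. x ^ (k + 2) / fact (k + 2)) sums (exp x - (\<Sum>k<2. x ^ k / fact k))"
    using exp_converges[of x] by (intro sums_split_initial_segment) (simp add: scaleR_conv_of_real field_simps)
  have "exp x - (\<Sum>k<2. x ^ k / fact k) \<le> x\<^sup>2 / 2 * (1 / (1 - x / 3))"
  proof (rule sums_le[OF _ ex geo])
    fix k
    have "x ^ (k + 2) / fact (k + 2) \<le> x ^ (k + 2) / (2 * 3 ^ k)"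
      using True by (intro divide_left_mono two_power3_le_fact) auto
    also have "\<dots> = x\<^sup>2 / 2 * (x / 3) ^ k"
      by (simp add: power_add power_divide power2_eq_square)
    finally show "x ^ (k + 2) / fact (k + 2) \<le> x\<^sup>2 / 2 * (x / 3) ^ k" .
  qed
  also have "\<dots> = x\<^sup>2 / (2 * (1 - x / 3))" by simp
  also have "\<dots> \<le> x\<^sup>2 / (2 * (1 - b / 3))"
    using assms by (intro divide_left_mono) auto
  finally show ?thesis by (simp add: numeral_2_eq_2)
next
  case False
  obtain t where "exp x = (\<Sum>m<3. x ^ m / fact m) + exp t / fact 3 * x ^ 3"
    using Maclaurin_exp_le[of x 3] by auto
  moreover have "exp t / fact 3 * x ^ 3 \<le> 0"
    using False by (intro mult_nonneg_nonpos) (auto simp: power_le_zero_eq)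
  ultimately have "exp x \<le> 1 + x + x\<^sup>2 / 2"
    by (simp add: numeral_3_eq_3 power2_eq_square)
  also have "x\<^sup>2 / 2 \<le> x\<^sup>2 / (2 * (1 - b / 3))"
    using assms by (intro divide_left_mono) auto
  finally show ?thesis by simp
qed

lemma oscillation_le_minus_expectation:
  assumes fin: "finite (set_pmf p)" and osc: "oscillation_le p c u" and z: "z \<in> set_pmf p"
  shows "u z - measure_pmf.expectation p u \<le> c"
proof -
  have "measure_pmf.expectation p (\<lambda>_. u z - c) \<le> measure_pmf.expectation p u"
    using fin osc z by (intro expectation_mono_finite) (auto simp: oscillation_le_def algebra_simps)
  then show ?thesis by simp
qed

text \<open>Apply \<open>exp_minus_linear_le\<close> with \<open>b = s * c\<close> to the centred
  variable, which is at most \<open>c\<close> from above. The linear term averages to zero, the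
  quadratic one to the variance, and \<open>1 + t\<close> is at most \<open>exp t\<close>.\<close>

lemma mgf_variance_le:
  fixes u :: "'a \<Rightarrow> real"
  assumes fin: "finite (set_pmf p)" and osc: "oscillation_le p c u"
    and var: "measure_pmf.variance p u \<le> w" and s: "0 \<le> s" "s * c < 3" and c: "0 \<le> c"
  shows "measure_pmf.expectation p (\<lambda>z. exp (s * (u z - measure_pmf.expectation p u)))
           \<le> exp (s\<^sup>2 * w / (2 * (1 - s * c / 3)))"
proof -
  note [simp] = integrable_measure_pmf_finite[OF fin]
  let ?D = "\<lambda>z. u z - measure_pmf.expectation p u"
  have "measure_pmf.expectation p (\<lambda>z. exp (s * ?D z))
      \<le> measure_pmf.expectation p (\<lambda>z. 1 + s * ?D z + (s * ?D z)\<^sup>2 / (2 * (1 - s * c / 3)))"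
    using s c oscillation_le_minus_expectation[OF fin osc]
    by (intro expectation_mono_finite exp_minus_linear_le fin mult_left_mono) auto
  also have "\<dots> = 1 + s\<^sup>2 * measure_pmf.variance p u / (2 * (1 - s * c / 3))"
    by (simp add: power_mult_distrib)
  also have "\<dots> \<le> 1 + s\<^sup>2 * w / (2 * (1 - s * c / 3))"
    using s var by (intro add_left_mono divide_right_mono mult_left_mono) (auto simp: mult.commute)
  also have "\<dots> \<le> exp (s\<^sup>2 * w / (2 * (1 - s * c / 3)))"
    by (rule exp_ge_add_one_self)
  finally show ?thesis .
qed

section \<open>Chernoff, McDiarmid and Bernstein tail bounds\<close>

lemma chernoff_pmf:
  fixes F :: "'a \<Rightarrow> real"
  assumes fin: "finite (set_pmf p)" and "s > 0"
    and mgf: "measure_pmf.expectation p (\<lambda>x. exp (s * (F x - measure_pmf.expectation p F))) \<le> exp r"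
  shows "measure_pmf.prob p {x. F x < measure_pmf.expectation p F + \<epsilon>} \<ge> 1 - exp (r - s * \<epsilon>)"
proof -
  let ?e = "measure_pmf.expectation p F"
  have "measure_pmf.prob p {x. F x \<ge> ?e + \<epsilon>} = measure_pmf.prob p {x \<in> space p. exp (s * (F x - ?e)) \<ge> exp (s * \<epsilon>)}"
    using \<open>s > 0\<close> by (intro arg_cong[where f = "measure_pmf.prob p"]) auto
  also have "\<dots> \<le> measure_pmf.expectation p (\<lambda>x. exp (s * (F x - ?e))) / exp (s * \<epsilon>)"
    by (rule integral_Markov_inequality_measure[where A = "{}"]) (auto intro: integrable_measure_pmf_finite fin)
  also have "\<dots> \<le> exp r / exp (s * \<epsilon>)"
    using mgf by (intro divide_right_mono) auto
  also have "\<dots> = exp (r - s * \<epsilon>)" by (simp add: exp_diff)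
  finally have "measure_pmf.prob p {x. F x \<ge> ?e + \<epsilon>} \<le> exp (r - s * \<epsilon>)" .
  moreover have "{x. F x \<ge> ?e + \<epsilon>} = space p - {x. F x < ?e + \<epsilon>}" by auto
  ultimately show ?thesis
    using measure_pmf.prob_compl[of "{x. F x < ?e + \<epsilon>}" p] by simp
qed

lemma mcdiarmid_Pi_pmf:
  fixes F :: "('i \<Rightarrow> 'a) \<Rightarrow> real" and c \<epsilon> :: real
  assumes I: "finite I" "I \<noteq> {}" and fin: "\<And>i. i \<in> I \<Longrightarrow> finite (set_pmf (p i))"
    and osc: "\<And>i x. i \<in> I \<Longrightarrow> x \<in> PiE_dflt (I - {i}) d (set_pmf \<circ> p) \<Longrightarrow>
                oscillation_le (p i) c (\<lambda>z. F (x(i := z)))"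
    and "c > 0" "\<epsilon> > 0"
  shows "measure_pmf.prob (Pi_pmf I d p) {x. F x < measure_pmf.expectation (Pi_pmf I d p) F + \<epsilon>}
           \<ge> 1 - exp (- (2 * \<epsilon>\<^sup>2 / (card I * c\<^sup>2)))"
proof -
  \<comment> \<open>The minimiser of the Chernoff exponent
    \<open>card I * (s\<^sup>2 * c\<^sup>2 / 8) - s * \<epsilon>\<close>.\<close>
  define s where "s = 4 * \<epsilon> / (card I * c\<^sup>2)"
  have n: "real (card I) > 0" using I by (simp add: card_gt_0_iff)
  have s: "s > 0" unfolding s_def using assms n by simp
  have "measure_pmf.expectation (Pi_pmf I d p)
      (\<lambda>x. exp (s * (F x - measure_pmf.expectation (Pi_pmf I d p) F))) \<le> (\<Prod>i\<in>I. exp (s\<^sup>2 * c\<^sup>2 / 8))"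
    by (rule mgf_Pi_pmf_le[where Q = "\<lambda>i. oscillation_le (p i) c"])
       (use I fin osc s in \<open>auto intro: oscillation_le_expectation mgf_oscillation_le\<close>)
  also have "\<dots> = exp (card I * (s\<^sup>2 * c\<^sup>2 / 8))" by (simp add: exp_of_nat_mult[symmetric])
  finally have "measure_pmf.prob (Pi_pmf I d p) {x. F x < measure_pmf.expectation (Pi_pmf I d p) F + \<epsilon>}
      \<ge> 1 - exp (card I * (s\<^sup>2 * c\<^sup>2 / 8) - s * \<epsilon>)"
    using I fin s by (intro chernoff_pmf finite_set_Pi_pmf) auto
  also have "card I * (s\<^sup>2 * c\<^sup>2 / 8) - s * \<epsilon> = - (2 * \<epsilon>\<^sup>2 / (card I * c\<^sup>2))"
    unfolding s_def using n \<open>c > 0\<close> by (simp add: field_simps power2_eq_square)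
  finally show ?thesis .
qed

lemma bernstein_Pi_pmf:
  fixes F :: "('i \<Rightarrow> 'a) \<Rightarrow> real" and c \<epsilon> :: real
  assumes I: "finite I" and fin: "\<And>i. i \<in> I \<Longrightarrow> finite (set_pmf (p i))"
    and osc: "\<And>i x. i \<in> I \<Longrightarrow> x \<in> PiE_dflt (I - {i}) d (set_pmf \<circ> p) \<Longrightarrow>
                oscillation_le (p i) c (\<lambda>z. F (x(i := z)))"
    and var: "\<And>i x. i \<in> I \<Longrightarrow> x \<in> PiE_dflt (I - {i}) d (set_pmf \<circ> p) \<Longrightarrow>
                measure_pmf.variance (p i) (\<lambda>z. F (x(i := z))) \<le> w i"
    and w: "\<And>i. i \<in> I \<Longrightarrow> 0 \<le> w i" and "c > 0" "\<epsilon> > 0"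
  shows "measure_pmf.prob (Pi_pmf I d p) {x. F x < measure_pmf.expectation (Pi_pmf I d p) F + \<epsilon>}
           \<ge> 1 - exp (- (\<epsilon>\<^sup>2 / (2 * ((\<Sum>i\<in>I. w i) + c * \<epsilon> / 3))))"
proof -
  define V where "V = (\<Sum>i\<in>I. w i)"
  have V: "V \<ge> 0" unfolding V_def by (intro sum_nonneg w)
  have bound: "measure_pmf.prob (Pi_pmf I d p) {x. F x < measure_pmf.expectation (Pi_pmf I d p) F + \<epsilon>}
      \<ge> 1 - exp (s\<^sup>2 * V / (2 * (1 - s * c / 3)) - s * \<epsilon>)" if s: "s > 0" "s * c < 3" for s
  proof -
    have "measure_pmf.expectation (Pi_pmf I d p)
        (\<lambda>x. exp (s * (F x - measure_pmf.expectation (Pi_pmf I d p) F)))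
        \<le> (\<Prod>i\<in>I. exp (s\<^sup>2 * w i / (2 * (1 - s * c / 3))))"
      \<comment> \<open>The one-coordinate bound uses oscillation and variance together, so
        \<open>Q\<close> is their conjunction; both conjuncts are stable under averaging.\<close>
      by (rule mgf_Pi_pmf_le[where Q = "\<lambda>i u. oscillation_le (p i) c u \<and> measure_pmf.variance (p i) u \<le> w i"])
         (use I fin osc var s \<open>c > 0\<close> in
           \<open>auto intro!: oscillation_le_expectation variance_expectation_le mgf_variance_le
             simp del: right_diff_distrib_numeral\<close>)
    also have "\<dots> = exp (s\<^sup>2 * V / (2 * (1 - s * c / 3)))"
      by (simp add: exp_sum[OF I, symmetric] V_def sum_distrib_left sum_divide_distrib)
    finally show ?thesis
      using I fin s by (intro chernoff_pmf finite_set_Pi_pmf) auto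
  qed
  show ?thesis
  proof (cases "V = 0")
    \<comment> \<open>The usual choice of \<open>s\<close> degenerates to the excluded value \<open>3 / c\<close>; half of it suffices.\<close>
    case True
    have "3 / (2 * c) > 0" "3 / (2 * c) * c < 3" using \<open>c > 0\<close> by auto
    from bound[OF this] True have "measure_pmf.prob (Pi_pmf I d p)
        {x. F x < measure_pmf.expectation (Pi_pmf I d p) F + \<epsilon>} \<ge> 1 - exp (- (3 / (2 * c) * \<epsilon>))" by simp
    also have "3 / (2 * c) * \<epsilon> = \<epsilon>\<^sup>2 / (2 * (V + c * \<epsilon> / 3))"
      using True \<open>c > 0\<close> \<open>\<epsilon> > 0\<close> by (simp add: field_simps power2_eq_square)
    finally show ?thesis by (simp add: V_def)
  next
    case False
    with V have V: "V > 0" by simp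
    \<comment> \<open>With \<open>s = \<epsilon> / T\<close> this \<open>T\<close> gives
      \<open>1 - s * c / 3 = V / T\<close>. The exponent then becomes
      \<open>s\<^sup>2 * T / 2 - s * \<epsilon>\<close>, and this \<open>s\<close> is exactly the
      minimiser of that quadratic.\<close>
    define T where "T = V + c * \<epsilon> / 3"
    define s where "s = \<epsilon> / T"
    have T: "T > 0" unfolding T_def using V \<open>c > 0\<close> \<open>\<epsilon> > 0\<close> by (simp add: add_pos_pos)
    have s: "s > 0" unfolding s_def using T \<open>\<epsilon> > 0\<close> by simp
    have one_minus: "1 - s * c / 3 = V / T"
      unfolding s_def using T by (simp add: field_simps T_def)
    with V T have "1 - s * c / 3 > 0" by simp
    then have "s * c < 3" by simp
    from bound[OF s this] have "measure_pmf.prob (Pi_pmf I d p)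
        {x. F x < measure_pmf.expectation (Pi_pmf I d p) F + \<epsilon>}
        \<ge> 1 - exp (s\<^sup>2 * V / (2 * (V / T)) - s * \<epsilon>)" unfolding one_minus .
    also have "s\<^sup>2 * V / (2 * (V / T)) - s * \<epsilon> = - (\<epsilon>\<^sup>2 / (2 * T))"
      unfolding s_def using T V by (simp add: field_simps power2_eq_square)
    finally show ?thesis by (simp add: T_def V_def)
  qed
qed

section \<open>From the product distribution to independent random variables\<close>

text \<open>
  Equality holds as well, but the inequality only needs the atoms, and so no null sets of \<open>M\<close>.
\<close>

lemma (in prob_space) prob_Pi_pmf_le:
  fixes X :: "'i \<Rightarrow> 'a \<Rightarrow> 'b"
  assumes I: "finite I" "I \<noteq> {}" and fin: "\<And>i. i \<in> I \<Longrightarrow> finite (set_pmf (p i))"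
    and sub: "\<And>i. i \<in> I \<Longrightarrow> set_pmf (p i) \<subseteq> A i"
    and indep: "indep_vars (\<lambda>i. count_space (A i)) X I"
    and distr: "\<And>i. i \<in> I \<Longrightarrow> distr M (count_space UNIV) (X i) = measure_pmf (p i)"
    and meas: "{\<omega> \<in> space M. R (\<lambda>i\<in>I. X i \<omega>)} \<in> events"
  shows "measure_pmf.prob (Pi_pmf I undefined p) {x. R x} \<le> prob {\<omega> \<in> space M. R (\<lambda>i\<in>I. X i \<omega>)}"
proof -
  let ?PI = "Pi_pmf I undefined p"
  define S where "S = {x \<in> set_pmf ?PI. R x}"
  define B where "B x = (\<Inter>i\<in>I. X i -` {x i} \<inter> space M)" for x
  have S: "finite S" unfolding S_def using finite_set_Pi_pmf[OF I(1) fin] by simp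
  have rv: "X i \<in> M \<rightarrow>\<^sub>M count_space (A i)" if "i \<in> I" for i
    using indep that by (auto simp: indep_vars_def)
  have SD: "x i \<in> set_pmf (p i)" if "x \<in> S" "i \<in> I" for x i
    using that I by (auto simp: S_def set_Pi_pmf PiE_dflt_def)
  \<comment> \<open>Off \<open>I\<close> both the atoms of the product and the restricted function
    take the value \<open>undefined\<close>. Agreement on \<open>I\<close> is therefore equality,
    which makes \<open>B x\<close> the event that the sample is \<open>x\<close>.\<close>
  have Sout: "x i = undefined" if "x \<in> S" "i \<notin> I" for x i
    using that I by (auto simp: S_def set_Pi_pmf PiE_dflt_def)
  have atom: "X i -` {a} \<inter> space M \<in> events" "prob (X i -` {a} \<inter> space M) = pmf (p i) a"
    if i: "i \<in> I" and a: "a \<in> set_pmf (p i)" for i a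
  proof -
    show "X i -` {a} \<inter> space M \<in> events"
      using sub[OF i] a by (intro measurable_sets[OF rv[OF i]]) auto
    \<comment> \<open>Independence refers to the discrete space on \<open>A i\<close>, whereas the
      law of \<open>X i\<close> is given on the whole type; enlarging the target reconciles the
      two.\<close>
    have "X i \<in> M \<rightarrow>\<^sub>M count_space UNIV"
      using rv[OF i] by (rule measurable_compose) auto
    then have "prob (X i -` {a} \<inter> space M) = measure (distr M (count_space UNIV) (X i)) {a}"
      by (subst measure_distr) auto
    then show "prob (X i -` {a} \<inter> space M) = pmf (p i) a"
      by (simp add: distr[OF i] measure_pmf_single)
  qed
  have B: "B x \<in> events" "prob (B x) = pmf ?PI x" if x: "x \<in> S" for x
  proof -
    show "B x \<in> events" unfolding B_def using I atom SD[OF x] by (intro sets.finite_INT) auto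
    have "prob (B x) = (\<Prod>i\<in>I. prob (X i -` {x i} \<inter> space M))"
      unfolding B_def using SD[OF x] sub I by (intro indep_varsD_finite[OF indep]) auto
    also have "\<dots> = (\<Prod>i\<in>I. pmf (p i) (x i))"
      using atom SD[OF x] by (intro prod.cong) auto
    also have "\<dots> = pmf ?PI x"
      using I Sout[OF x] by (intro pmf_Pi'[symmetric]) auto
    finally show "prob (B x) = pmf ?PI x" .
  qed
  have BX: "(\<lambda>i\<in>I. X i \<omega>) = x" "\<omega> \<in> space M" if "x \<in> S" "\<omega> \<in> B x" for x \<omega>
    using that Sout[OF that(1)] I by (auto simp: B_def fun_eq_iff)
  have "measure_pmf.prob ?PI {x. R x} = measure_pmf.prob ?PI ({x. R x} \<inter> set_pmf ?PI)"
    by (rule measure_Int_set_pmf[symmetric])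
  also have "{x. R x} \<inter> set_pmf ?PI = S" by (auto simp: S_def)
  also have "measure_pmf.prob ?PI S = (\<Sum>x\<in>S. prob (B x))"
    using S B by (simp add: measure_measure_pmf_finite)
  also have "\<dots> = prob (\<Union>x\<in>S. B x)"
  proof (rule finite_measure_finite_Union[symmetric, OF S])
    show "disjoint_family_on B S"
      unfolding disjoint_family_on_def using BX by (metis disjoint_iff)
  qed (use B in auto)
  also have "\<dots> \<le> prob {\<omega> \<in> space M. R (\<lambda>i\<in>I. X i \<omega>)}"
  proof (rule finite_measure_mono[OF _ meas])
    show "(\<Union>x\<in>S. B x) \<subseteq> {\<omega> \<in> space M. R (\<lambda>i\<in>I. X i \<omega>)}"
      using BX by (auto simp: S_def)
  qed
  finally show ?thesis .
qed

subsection \<open>Expectation of functions with Lipschitz gradient\<close>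

text \<open>Follow the segment \<open>\<gamma>\<close> from \<open>x\<close> to \<open>y\<close> and
  let \<open>\<psi>\<close> be \<open>\<phi>\<close> along it minus the linear and quadratic terms.
  By Cauchy-Schwarz and the Lipschitz bound, the derivative of \<open>\<psi>\<close> is nonpositive
  at the mean value point, so \<open>\<psi>\<close> does not increase from 0 to 1.\<close>

lemma lipschitz_gradient_upper_bound:
  fixes \<phi> :: "'e::real_inner \<Rightarrow> real"
  assumes grad: "has_gradient_on \<phi> G E U" and "C \<subseteq> U" "C \<subseteq> E" "convex C"
    and lip: "K-lipschitz_on C G" and x: "x \<in> C" and y: "y \<in> C"
  shows "\<phi> y \<le> \<phi> x + inner (G x) (y - x) + K / 2 * (norm (y - x))\<^sup>2"
proof -
  define d where "d = y - x"
  define \<gamma> where "\<gamma> = (\<lambda>t. x + t *\<^sub>R d)"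
  have \<gamma>C: "\<gamma> t \<in> C" if "t \<in> {0..1}" for t
  proof -
    have "\<gamma> t = (1 - t) *\<^sub>R x + t *\<^sub>R y" by (simp add: \<gamma>_def d_def algebra_simps)
    then show ?thesis using that \<open>convex C\<close> x y by (auto simp: convex_alt)
  qed
  define \<psi> where "\<psi> t = \<phi> (\<gamma> t) - t * inner (G x) d - K / 2 * t\<^sup>2 * (norm d)\<^sup>2" for t
  define \<psi>' where "\<psi>' t h = inner (G (\<gamma> t)) (h *\<^sub>R d) - h * inner (G x) d - K * t * h * (norm d)\<^sup>2" for t h
  have deriv: "(\<psi> has_derivative \<psi>' t) (at t within {0..1})" if t: "0 \<le> t" "t \<le> 1" for t
  proof -
    have "(\<gamma> has_derivative (\<lambda>h. h *\<^sub>R d)) (at t within {0..1})"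
      unfolding \<gamma>_def by (auto intro!: derivative_eq_intros)
    \<comment> \<open>The gradient describes a derivative within \<open>E\<close> only. The segment
      stays in \<open>C\<close>, hence in \<open>E\<close>, so that derivative restricts to it and
      the chain rule applies.\<close>
    moreover have "(\<phi> has_derivative inner (G (\<gamma> t))) (at (\<gamma> t) within \<gamma> ` {0..1})"
    proof (rule has_derivative_subset)
      show "(\<phi> has_derivative inner (G (\<gamma> t))) (at (\<gamma> t) within E)"
        using grad \<open>C \<subseteq> U\<close> \<gamma>C[of t] t by (auto simp: has_gradient_on_def)
    qed (use \<gamma>C \<open>C \<subseteq> E\<close> in auto)
    ultimately have "(\<phi> \<circ> \<gamma> has_derivative inner (G (\<gamma> t)) \<circ> (\<lambda>h. h *\<^sub>R d)) (at t within {0..1})"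
      by (rule diff_chain_within)
    then have "((\<lambda>t. \<phi> (\<gamma> t)) has_derivative (\<lambda>h. inner (G (\<gamma> t)) (h *\<^sub>R d))) (at t within {0..1})"
      by (simp add: o_def)
    then show ?thesis unfolding \<psi>_def \<psi>'_def
      by (auto intro!: derivative_eq_intros simp: algebra_simps)
  qed
  obtain t where t: "t \<in> {0<..<1}" and mvt: "\<psi> 1 - \<psi> 0 = \<psi>' t (1 - 0)"
    using mvt_simple[OF zero_less_one deriv] by blast
  have "inner (G (\<gamma> t) - G x) d \<le> norm (G (\<gamma> t) - G x) * norm d"
    by (rule norm_cauchy_schwarz)
  also have "\<dots> \<le> (K * norm (\<gamma> t - x)) * norm d"
    using lipschitz_onD[OF lip \<gamma>C x] t by (intro mult_right_mono) (auto simp: dist_norm)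
  also have "\<dots> = K * t * (norm d)\<^sup>2"
    using t by (simp add: \<gamma>_def power2_eq_square)
  finally have "\<psi>' t (1 - 0) \<le> 0"
    by (simp add: \<psi>'_def inner_diff_left)
  then have "\<psi> 1 \<le> \<psi> 0" using mvt by simp
  then show ?thesis by (simp add: \<psi>_def \<gamma>_def d_def)
qed

lemma expectation_in_convex:
  fixes Y :: "'a \<Rightarrow> 'e::{banach, second_countable_topology}"
  assumes "finite (set_pmf p)" "convex C" "\<And>z. z \<in> set_pmf p \<Longrightarrow> Y z \<in> C"
  shows "measure_pmf.expectation p Y \<in> C"
  unfolding expectation_finite_sum[OF assms(1)]
  using assms by (intro convex_sum) (auto simp: sum_pmf_eq_1)

text \<open>Expand around the mean \<open>m\<close>, which convexity keeps in \<open>C\<close>; the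
  first-order term pairs the fixed vector \<open>G m\<close> with a centred variable.\<close>

lemma expectation_lipschitz_gradient_le:
  fixes \<phi> :: "'e::{real_inner, banach, second_countable_topology} \<Rightarrow> real"
  assumes fin: "finite (set_pmf p)" and grad: "has_gradient_on \<phi> G E U"
    and C: "C \<subseteq> U" "C \<subseteq> E" "convex C" and lip: "K-lipschitz_on C G"
    and Y: "\<And>z. z \<in> set_pmf p \<Longrightarrow> Y z \<in> C"
  shows "measure_pmf.expectation p (\<lambda>z. \<phi> (Y z)) \<le> \<phi> (measure_pmf.expectation p Y)
           + K / 2 * measure_pmf.expectation p (\<lambda>z. (norm (Y z - measure_pmf.expectation p Y))\<^sup>2)"
proof -
  note [simp] = integrable_measure_pmf_finite[OF fin]
  define m where "m = measure_pmf.expectation p Y"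
  have "m \<in> C" unfolding m_def by (intro expectation_in_convex fin C Y)
  then have "measure_pmf.expectation p (\<lambda>z. \<phi> (Y z))
      \<le> measure_pmf.expectation p (\<lambda>z. \<phi> m + inner (G m) (Y z - m) + K / 2 * (norm (Y z - m))\<^sup>2)"
    by (intro expectation_mono_finite fin lipschitz_gradient_upper_bound[OF grad C lip] Y)
  also have "\<dots> = \<phi> m + inner (G m) (measure_pmf.expectation p (\<lambda>z. Y z - m))
      + K / 2 * measure_pmf.expectation p (\<lambda>z. (norm (Y z - m))\<^sup>2)"
    by simp
  also have "measure_pmf.expectation p (\<lambda>z. Y z - m) = 0"
    by (simp add: m_def)
  finally show ?thesis by (simp add: m_def)
qed

section \<open>Mean and variance of sums of independent coordinates\<close>

lemma expectation_sum_Pi_pmf: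
  fixes F :: "'i \<Rightarrow> 'a \<Rightarrow> 'e::{banach, second_countable_topology}"
  assumes I: "finite I" and fin: "\<And>i. i \<in> I \<Longrightarrow> finite (set_pmf (p i))"
  shows "measure_pmf.expectation (Pi_pmf I d p) (\<lambda>x. \<Sum>i\<in>I. F i (x i))
           = (\<Sum>i\<in>I. measure_pmf.expectation (p i) (F i))"
proof -
  have "measure_pmf.expectation (Pi_pmf I d p) (\<lambda>x. F i (x i)) = measure_pmf.expectation (p i) (F i)"
    if "i \<in> I" for i
  proof -
    have "p i = map_pmf (\<lambda>x. x i) (Pi_pmf I d p)"
      using Pi_pmf_component[OF I, of i d p] that by simp
    then show ?thesis by simp
  qed
  then show ?thesis
    using integrable_measure_pmf_finite[OF finite_set_Pi_pmf[OF I fin]]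
    by (subst Bochner_Integration.integral_sum) auto
qed

text \<open>Pythagoras, one coordinate at a time: the new centred summand is orthogonal in mean to
  the sum of the others.\<close>

lemma variance_sum_Pi_pmf:
  fixes F :: "'i \<Rightarrow> 'a \<Rightarrow> 'e::{real_inner, banach, second_countable_topology}"
  assumes "finite I" and "\<And>i. i \<in> I \<Longrightarrow> finite (set_pmf (p i))"
  shows "measure_pmf.expectation (Pi_pmf I d p)
           (\<lambda>x. (norm (\<Sum>i\<in>I. F i (x i) - measure_pmf.expectation (p i) (F i)))\<^sup>2)
       = (\<Sum>i\<in>I. measure_pmf.expectation (p i) (\<lambda>z. (norm (F i z - measure_pmf.expectation (p i) (F i)))\<^sup>2))"
  using assms
proof (induction I rule: finite_induct)
  case empty
  then show ?case by simp
next
  case (insert i I)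
  let ?D = "\<lambda>i z. F i z - measure_pmf.expectation (p i) (F i)"
  let ?W = "\<lambda>x. \<Sum>k\<in>I. ?D k (x k)"
  let ?PI = "Pi_pmf I d p"
  have fin: "finite (set_pmf ?PI)" "finite (set_pmf (p i))"
    using insert by (auto intro!: finite_set_Pi_pmf)
  note [simp] = integrable_measure_pmf_finite[OF fin(1)] integrable_measure_pmf_finite[OF fin(2)]
  have W0: "measure_pmf.expectation ?PI ?W = 0"
    using insert
    by (subst expectation_sum_Pi_pmf[where F = ?D])
       (auto simp: integrable_measure_pmf_finite intro!: sum.neutral)
  have "(norm (?D i z + ?W x))\<^sup>2 = (norm (?D i z))\<^sup>2 + 2 * inner (?D i z) (?W x) + (norm (?W x))\<^sup>2" for z x
    by (simp only: power2_norm_eq_inner inner_add_left inner_add_right inner_commute[of "?W x" "?D i z"])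
  \<comment> \<open>For fixed \<open>z\<close>, the inner product with \<open>?D i z\<close>
    commutes with the expectation over the other coordinates, so the cross term is a multiple of a
    pairing with the mean of \<open>?W\<close>, which \<open>W0\<close> annihilates.\<close>
  then have step: "measure_pmf.expectation ?PI (\<lambda>x. (norm (?D i z + ?W x))\<^sup>2)
      = (norm (?D i z))\<^sup>2 + 2 * inner (?D i z) (measure_pmf.expectation ?PI ?W)
        + measure_pmf.expectation ?PI (\<lambda>x. (norm (?W x))\<^sup>2)" for z
    by (simp del: integral_diff Bochner_Integration.integral_sum)
  have split: "(\<Sum>k\<in>insert i I. ?D k ((x(i := z)) k)) = ?D i z + ?W x" for x z
  proof -
    have "(\<Sum>k\<in>I. ?D k ((x(i := z)) k)) = ?W x"
      using insert.hyps by (intro sum.cong) auto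
    then show ?thesis
      by (simp only: sum.insert[OF insert.hyps] fun_upd_same)
  qed
  have "measure_pmf.expectation (Pi_pmf (insert i I) d p) (\<lambda>x. (norm (\<Sum>i\<in>insert i I. ?D i (x i)))\<^sup>2)
      = measure_pmf.expectation (p i) (\<lambda>z. measure_pmf.expectation ?PI
          (\<lambda>x. (norm (\<Sum>k\<in>insert i I. ?D k ((x(i := z)) k)))\<^sup>2))"
    using insert by (intro expectation_Pi_pmf_insert) auto
  also have "\<dots> = measure_pmf.expectation (p i) (\<lambda>z. measure_pmf.expectation ?PI (\<lambda>x. (norm (?D i z + ?W x))\<^sup>2))"
    by (simp only: split)
  also have "\<dots> = measure_pmf.expectation (p i) (\<lambda>z. (norm (?D i z))\<^sup>2)
        + measure_pmf.expectation ?PI (\<lambda>x. (norm (?W x))\<^sup>2)"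
    unfolding step W0 by simp
  finally show ?case
    using insert by simp
qed

subsection \<open>The randomized cost\<close>

lemma pmf_var_real:
  fixes F :: "'a \<Rightarrow> real"
  assumes "finite (set_pmf p)"
  shows "pmf_var p F = measure_pmf.variance p F"
  by (simp add: pmf_var_eq_expectation[OF assms] pmf_mean_eq_expectation[OF assms])

text \<open>The closed ball around any \<open>F z\<close> with the diameter as radius contains all
  values of \<open>F\<close> on the support and is convex, so it also contains the mean.\<close>

lemma pmf_var_le_diameter:
  fixes F :: "'a \<Rightarrow> 'h::{real_inner, banach, second_countable_topology}"
  assumes fin: "finite (set_pmf p)" and bdd: "bounded (F ` A)" and sub: "set_pmf p \<subseteq> A"
  shows "pmf_var p F \<le> (diameter (F ` A))\<^sup>2"
proof -
  have dev: "norm (F z - pmf_mean p F) \<le> diameter (F ` A)" if z: "z \<in> set_pmf p" for z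
  proof -
    have "measure_pmf.expectation p F \<in> cball (F z) (diameter (F ` A))"
    proof (rule expectation_in_convex[OF fin convex_cball])
      fix y assume "y \<in> set_pmf p"
      then show "F y \<in> cball (F z) (diameter (F ` A))"
        using z sub by (auto intro!: diameter_bounded_bound[OF bdd])
    qed
    then show ?thesis by (simp add: pmf_mean_eq_expectation[OF fin] dist_norm)
  qed
  have "pmf_var p F \<le> measure_pmf.expectation p (\<lambda>_. (diameter (F ` A))\<^sup>2)"
    unfolding pmf_var_eq_expectation[OF fin]
    by (intro expectation_mono_finite fin power_mono dev) auto
  then show ?thesis by simp
qed

lemma aggregate_set_memI:
  assumes "\<And>i. i \<in> {1..N} \<Longrightarrow> x i \<in> \<X> i"
  shows "(1 / real N) *\<^sub>R (\<Sum>i=1..N. g i j (x i)) \<in> aggregate_set N \<X> g j"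
proof -
  have "(\<Sum>i\<in>{1..N}. g i j (x i)) \<in> (\<Sum>i\<in>{1..N}. g i j ` \<X> i)"
    using assms by (auto simp: set_sum_alt intro!: exI[of _ "\<lambda>i. g i j (x i)"])
  then show ?thesis by (auto simp: aggregate_set_def)
qed

section \<open>Mean, oscillation and measurability of the cost\<close>

locale randomized_cost =
  fixes N M :: nat
    and \<X> :: "nat \<Rightarrow> 'a set"
    and E :: "nat \<Rightarrow> 'e::{real_inner, banach, second_countable_topology} set"
    and f :: "nat \<Rightarrow> 'e \<Rightarrow> real"
    and g :: "nat \<Rightarrow> nat \<Rightarrow> 'a \<Rightarrow> 'e"
    and L L' :: "nat \<Rightarrow> real"
    and \<mu> :: "nat \<Rightarrow> 'a pmf"
  assumes N: "N \<ge> 1"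
    and regular: "cost_regularity N M \<X> E f g L L'"
    and \<mu>: "\<And>i. i \<in> {1..N} \<Longrightarrow> \<mu> i \<in> finsupp_pmfs (\<X> i)"
begin

abbreviation aggregate :: "nat \<Rightarrow> (nat \<Rightarrow> 'a) \<Rightarrow> 'e" where
  "aggregate j x \<equiv> (1 / real N) *\<^sub>R (\<Sum>i=1..N. g i j (x i))"

abbreviation aggregate_hull :: "nat \<Rightarrow> 'e set" where
  "aggregate_hull j \<equiv> convex hull (aggregate_set N \<X> g j)"

text \<open>The default \<open>undefined\<close> is the value that a function restricted to
  \<open>{1..N}\<close> takes elsewhere, so atoms of this distribution are directly comparable with
  samples of the restricted \<open>X\<close>.\<close>

abbreviation product_pmf :: "(nat \<Rightarrow> 'a) pmf" where
  "product_pmf \<equiv> Pi_pmf {1..N} undefined \<mu>"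

lemma finite_support: "i \<in> {1..N} \<Longrightarrow> finite (set_pmf (\<mu> i))"
  and support_subset: "i \<in> {1..N} \<Longrightarrow> set_pmf (\<mu> i) \<subseteq> \<X> i"
  using \<mu> by (auto simp: finsupp_pmfs_def)

lemma finite_product_support: "finite (set_pmf product_pmf)"
  by (intro finite_set_Pi_pmf finite_support) auto

lemma bounded_g: "i \<in> {1..N} \<Longrightarrow> j \<in> {1..M} \<Longrightarrow> bounded (g i j ` \<X> i)"
  and lipschitz_f: "j \<in> {1..M} \<Longrightarrow> (L j)-lipschitz_on (aggregate_hull j) (f j)"
  using regular by (auto simp: cost_regularity_def)

lemma aggregate_in_hull:
  "(\<And>i. i \<in> {1..N} \<Longrightarrow> x i \<in> \<X> i) \<Longrightarrow> aggregate j x \<in> aggregate_hull j"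
  by (intro hull_inc aggregate_set_memI)

lemma product_support_memD: "x \<in> set_pmf product_pmf \<Longrightarrow> i \<in> {1..N} \<Longrightarrow> x i \<in> \<X> i"
  using support_subset[of i] by (auto simp: set_Pi_pmf PiE_dflt_def)

lemma J_cost_eq: "J_cost N M f g x = (\<Sum>j=1..M. f j (aggregate j x))"
  by (simp add: J_cost_def separable_cost_def)

lemma J_cost_cong: "(\<And>i. i \<in> {1..N} \<Longrightarrow> x i = y i) \<Longrightarrow> J_cost N M f g x = J_cost N M f g y"
  by (simp add: J_cost_eq)

lemma expectation_aggregate:
  "measure_pmf.expectation product_pmf (aggregate j) = (1 / real N) *\<^sub>R (\<Sum>i=1..N. pmf_mean (\<mu> i) (g i j))"
proof -
  have "measure_pmf.expectation product_pmf (\<lambda>x. \<Sum>i=1..N. g i j (x i))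
      = (\<Sum>i=1..N. measure_pmf.expectation (\<mu> i) (g i j))"
    by (rule expectation_sum_Pi_pmf[where F = "\<lambda>i. g i j"]) (auto intro: finite_support)
  also have "\<dots> = (\<Sum>i=1..N. pmf_mean (\<mu> i) (g i j))"
    by (intro sum.cong) (auto simp: pmf_mean_eq_expectation finite_support)
  finally show ?thesis by simp
qed

lemma variance_aggregate:
  "measure_pmf.expectation product_pmf
      (\<lambda>x. (norm (aggregate j x - measure_pmf.expectation product_pmf (aggregate j)))\<^sup>2)
    = (\<Sum>i=1..N. pmf_var (\<mu> i) (g i j)) / (real N)\<^sup>2"
proof -
  let ?m = "\<lambda>i. measure_pmf.expectation (\<mu> i) (g i j)"
  have mean: "pmf_mean (\<mu> i) (g i j) = ?m i" if "i \<in> {1..N}" for i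
    using that by (intro pmf_mean_eq_expectation finite_support)
  have "aggregate j x - measure_pmf.expectation product_pmf (aggregate j)
      = (1 / real N) *\<^sub>R (\<Sum>i=1..N. g i j (x i) - ?m i)" for x
    unfolding expectation_aggregate by (simp add: mean sum_subtractf scaleR_diff_right)
  then have "measure_pmf.expectation product_pmf
      (\<lambda>x. (norm (aggregate j x - measure_pmf.expectation product_pmf (aggregate j)))\<^sup>2)
    = measure_pmf.expectation product_pmf (\<lambda>x. (norm (\<Sum>i=1..N. g i j (x i) - ?m i))\<^sup>2 / (real N)\<^sup>2)"
    by (simp only: norm_scaleR power_mult_distrib) (simp add: power_divide)
  also have "\<dots> = measure_pmf.expectation product_pmf (\<lambda>x. (norm (\<Sum>i=1..N. g i j (x i) - ?m i))\<^sup>2) / (real N)\<^sup>2"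
    by simp
  also have "measure_pmf.expectation product_pmf (\<lambda>x. (norm (\<Sum>i=1..N. g i j (x i) - ?m i))\<^sup>2)
      = (\<Sum>i=1..N. measure_pmf.expectation (\<mu> i) (\<lambda>z. (norm (g i j z - ?m i))\<^sup>2))"
    by (rule variance_sum_Pi_pmf[where F = "\<lambda>i. g i j"]) (auto intro: finite_support)
  also have "\<dots> = (\<Sum>i=1..N. pmf_var (\<mu> i) (g i j))"
    by (intro sum.cong) (auto simp: pmf_var_eq_expectation finite_support mean)
  finally show ?thesis .
qed

lemma expectation_J_cost_le:
  "measure_pmf.expectation product_pmf (J_cost N M f g)
     \<le> rand_cost N M f g \<mu> + (\<Sum>j=1..M. \<Sum>i=1..N. L' j / (2 * (real N)\<^sup>2) * pmf_var (\<mu> i) (g i j))"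
proof -
  have le: "measure_pmf.expectation product_pmf (\<lambda>x. f j (aggregate j x))
      \<le> f j ((1 / real N) *\<^sub>R (\<Sum>i=1..N. pmf_mean (\<mu> i) (g i j)))
        + (\<Sum>i=1..N. L' j / (2 * (real N)\<^sup>2) * pmf_var (\<mu> i) (g i j))" if j: "j \<in> {1..M}" for j
  proof -
    obtain U G where U: "openin (top_of_set (E j)) U" "aggregate_hull j \<subseteq> U"
      and G: "has_gradient_on (f j) G (E j) U" "(L' j)-lipschitz_on (aggregate_hull j) G"
      using regular j unfolding cost_regularity_def by blast
    \<comment> \<open>The neighbourhood \<open>U\<close> is relatively open in \<open>E j\<close>,
      hence contained in it; this puts the hull where the derivative of \<open>f j\<close> is
      taken.\<close>
    have "aggregate_hull j \<subseteq> E j" using U openin_imp_subset by blast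
    from expectation_lipschitz_gradient_le[OF finite_product_support G(1) U(2) this convex_convex_hull G(2),
        of "aggregate j"]
    have "measure_pmf.expectation product_pmf (\<lambda>x. f j (aggregate j x))
      \<le> f j ((1 / real N) *\<^sub>R (\<Sum>i=1..N. pmf_mean (\<mu> i) (g i j)))
        + L' j / 2 * ((\<Sum>i=1..N. pmf_var (\<mu> i) (g i j)) / (real N)\<^sup>2)"
      \<comment> \<open>The order matters: the left side of \<open>variance_aggregate\<close>
        contains the mean in unevaluated form, which the second unfolding would destroy.\<close>
      unfolding variance_aggregate unfolding expectation_aggregate
      using aggregate_in_hull product_support_memD by blast
    then show ?thesis by (simp add: sum_distrib_left sum_divide_distrib)
  qed
  have "measure_pmf.expectation product_pmf (J_cost N M f g)
      = (\<Sum>j=1..M. measure_pmf.expectation product_pmf (\<lambda>x. f j (aggregate j x)))"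
    unfolding J_cost_eq[abs_def]
    by (intro Bochner_Integration.integral_sum integrable_measure_pmf_finite finite_product_support)
  also have "\<dots> \<le> (\<Sum>j=1..M. f j ((1 / real N) *\<^sub>R (\<Sum>i=1..N. pmf_mean (\<mu> i) (g i j)))
        + (\<Sum>i=1..N. L' j / (2 * (real N)\<^sup>2) * pmf_var (\<mu> i) (g i j)))"
    by (intro sum_mono le)
  finally show ?thesis by (simp add: rand_cost_def separable_cost_def sum.distrib)
qed

text \<open>Each variance is at most a squared diameter. The factor \<open>1 / N\<close> inside
  \<open>C1_const\<close> combines with \<open>1 / (2 * N)\<close> to the coefficient on the
  left.\<close>

lemma variance_term_le_C1:
  "(\<Sum>j=1..M. \<Sum>i=1..N. L' j / (2 * (real N)\<^sup>2) * pmf_var (\<mu> i) (g i j)) \<le> C1_const N M \<X> g L' / (2 * real N)"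
proof -
  have L': "0 \<le> L' j" if "j \<in> {1..M}" for j
    using regular that unfolding cost_regularity_def by (blast intro: lipschitz_on_nonneg)
  have "(\<Sum>j=1..M. \<Sum>i=1..N. L' j / (2 * (real N)\<^sup>2) * pmf_var (\<mu> i) (g i j))
      \<le> (\<Sum>j=1..M. \<Sum>i=1..N. L' j / (2 * (real N)\<^sup>2) * (diameter (g i j ` \<X> i))\<^sup>2)"
    using L' by (intro sum_mono mult_left_mono pmf_var_le_diameter finite_support bounded_g support_subset) auto
  also have "\<dots> = C1_const N M \<X> g L' / (2 * real N)"
    by (simp add: C1_const_def sum_distrib_left sum_divide_distrib power2_eq_square mult_ac)
  finally show ?thesis .
qed

text \<open>Only the \<open>i\<close>-th summand of each aggregate changes, so the aggregate moves
  by at most a diameter over \<open>N\<close>. Both aggregates lie in the hull on which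
  \<open>f j\<close> is Lipschitz.\<close>

lemma J_cost_bounded_difference:
  assumes i: "i \<in> {1..N}" and x: "\<And>k. k \<in> {1..N} - {i} \<Longrightarrow> x k \<in> \<X> k" and z: "z \<in> \<X> i" "z' \<in> \<X> i"
  shows "J_cost N M f g (x(i := z)) - J_cost N M f g (x(i := z')) \<le> C0_const N M \<X> g L / N"
proof -
  have diff: "f j (aggregate j (x(i := z))) - f j (aggregate j (x(i := z')))
      \<le> L j * Max ((\<lambda>i. diameter (g i j ` \<X> i)) ` {1..N}) / N" if j: "j \<in> {1..M}" for j
  proof -
    have in_hull: "aggregate j (x(i := y)) \<in> aggregate_hull j" if "y \<in> \<X> i" for y
      using that x by (intro aggregate_in_hull) auto
    have "aggregate j (x(i := z)) - aggregate j (x(i := z')) = (1 / real N) *\<^sub>R (g i j z - g i j z')"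
      unfolding scaleR_diff_right[symmetric] sum_subtractf[symmetric]
      using i by (subst sum.remove[of _ i]) auto
    then have "dist (aggregate j (x(i := z))) (aggregate j (x(i := z'))) = dist (g i j z) (g i j z') / N"
      by (simp add: dist_norm)
    also have "\<dots> \<le> diameter (g i j ` \<X> i) / N"
      using z i j by (intro divide_right_mono diameter_bounded_bound bounded_g) auto
    also have "\<dots> \<le> Max ((\<lambda>i. diameter (g i j ` \<X> i)) ` {1..N}) / N"
      using i by (intro divide_right_mono Max_ge) auto
    finally have dist: "dist (aggregate j (x(i := z))) (aggregate j (x(i := z')))
        \<le> Max ((\<lambda>i. diameter (g i j ` \<X> i)) ` {1..N}) / N" .
    have "f j (aggregate j (x(i := z))) - f j (aggregate j (x(i := z')))
        \<le> dist (f j (aggregate j (x(i := z)))) (f j (aggregate j (x(i := z'))))"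
      by (simp add: dist_real_def)
    also have "\<dots> \<le> L j * dist (aggregate j (x(i := z))) (aggregate j (x(i := z')))"
      by (intro lipschitz_onD[OF lipschitz_f[OF j]] in_hull z)
    also have "\<dots> \<le> L j * (Max ((\<lambda>i. diameter (g i j ` \<X> i)) ` {1..N}) / N)"
      by (intro mult_left_mono dist lipschitz_on_nonneg[OF lipschitz_f[OF j]])
    finally show ?thesis by simp
  qed
  show ?thesis
    unfolding J_cost_eq C0_const_def sum_subtractf[symmetric] sum_divide_distrib
    by (intro sum_mono diff)
qed

lemma oscillation_J_cost:
  assumes "i \<in> {1..N}" "x \<in> PiE_dflt ({1..N} - {i}) undefined (set_pmf \<circ> \<mu>)"
  shows "oscillation_le (\<mu> i) (C0_const N M \<X> g L / N) (\<lambda>z. J_cost N M f g (x(i := z)))"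
  unfolding oscillation_le_def
  using assms support_subset by (intro ballI J_cost_bounded_difference) (fastforce simp: PiE_dflt_def)+

text \<open>Each \<open>X i\<close> maps measurably into a discrete space, so composing it with any
  \<open>g i j\<close> stays measurable. The aggregate takes values in the hull, where
  \<open>f j\<close> is continuous; measurability of \<open>f j\<close> is therefore taken on the
  Borel space restricted to the hull.\<close>

lemma measurable_J_cost:
  assumes X: "\<And>i. i \<in> {1..N} \<Longrightarrow> X i \<in> P \<rightarrow>\<^sub>M count_space (\<X> i)"
  shows "(\<lambda>\<omega>. J_cost N M f g (\<lambda>i\<in>{1..N}. X i \<omega>)) \<in> borel_measurable P"
proof -
  have "(\<lambda>\<omega>. f j (aggregate j (\<lambda>i. X i \<omega>))) \<in> borel_measurable P" if j: "j \<in> {1..M}" for j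
  proof (rule measurable_compose[of _ _ "restrict_space borel (aggregate_hull j)"])
    show "f j \<in> borel_measurable (restrict_space borel (aggregate_hull j))"
      by (intro borel_measurable_continuous_on_restrict lipschitz_on_continuous_on[OF lipschitz_f[OF j]])
    show "(\<lambda>\<omega>. aggregate j (\<lambda>i. X i \<omega>)) \<in> P \<rightarrow>\<^sub>M restrict_space borel (aggregate_hull j)"
    proof (rule measurable_restrict_space2)
      show "(\<lambda>\<omega>. aggregate j (\<lambda>i. X i \<omega>)) \<in> space P \<rightarrow> aggregate_hull j"
        using measurable_space[OF X] by (intro Pi_I aggregate_in_hull) auto
      have "(\<lambda>\<omega>. g i j (X i \<omega>)) \<in> borel_measurable P" if "i \<in> {1..N}" for i
        by (rule measurable_compose[OF X[OF that]]) simp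
      then show "(\<lambda>\<omega>. aggregate j (\<lambda>i. X i \<omega>)) \<in> borel_measurable P"
        by (intro borel_measurable_scaleR borel_measurable_const borel_measurable_sum) auto
    qed
  qed
  then have "(\<lambda>\<omega>. J_cost N M f g (\<lambda>i. X i \<omega>)) \<in> borel_measurable P"
    unfolding J_cost_eq by (intro borel_measurable_sum) auto
  moreover have "J_cost N M f g (\<lambda>i\<in>{1..N}. X i \<omega>) = J_cost N M f g (\<lambda>i. X i \<omega>)" for \<omega>
    by (intro J_cost_cong) auto
  ultimately show ?thesis by simp
qed

text \<open>The common last step of both bounds: the estimate of the expected cost enlarges the
  event, and the result passes from the product distribution to \<open>P\<close>. The free
  \<open>T\<close> admits both the diameter term and the variance term itself.\<close>

lemma prob_J_cost_ge:
  assumes P: "prob_space P"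
    and indep: "prob_space.indep_vars P (\<lambda>i. count_space (\<X> i)) X {1..N}"
    and distr: "\<And>i. i \<in> {1..N} \<Longrightarrow> distr P (count_space UNIV) (X i) = measure_pmf (\<mu> i)"
    and bound: "measure_pmf.prob product_pmf
        {x. J_cost N M f g x < measure_pmf.expectation product_pmf (J_cost N M f g) + \<epsilon>} \<ge> r"
    and T: "(\<Sum>j=1..M. \<Sum>i=1..N. L' j / (2 * (real N)\<^sup>2) * pmf_var (\<mu> i) (g i j)) \<le> T"
  shows "measure P {\<omega> \<in> space P. J_cost N M f g (\<lambda>i\<in>{1..N}. X i \<omega>) < rand_cost N M f g \<mu> + T + \<epsilon>} \<ge> r"
proof -
  interpret P: prob_space P by fact
  have "X i \<in> P \<rightarrow>\<^sub>M count_space (\<X> i)" if "i \<in> {1..N}" for i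
    using indep that by (auto simp: P.indep_vars_def)
  then have [measurable]: "(\<lambda>\<omega>. J_cost N M f g (\<lambda>i\<in>{1..N}. X i \<omega>)) \<in> borel_measurable P"
    by (rule measurable_J_cost)
  have event: "{\<omega> \<in> space P. J_cost N M f g (\<lambda>i\<in>{1..N}. X i \<omega>) < rand_cost N M f g \<mu> + T + \<epsilon>} \<in> P.events"
    by measurable
  note bound
  also have "measure_pmf.prob product_pmf
        {x. J_cost N M f g x < measure_pmf.expectation product_pmf (J_cost N M f g) + \<epsilon>}
      \<le> measure_pmf.prob product_pmf {x. J_cost N M f g x < rand_cost N M f g \<mu> + T + \<epsilon>}"
    using expectation_J_cost_le T by (intro measure_pmf.finite_measure_mono) auto
  also have "\<dots> \<le> measure P {\<omega> \<in> space P. J_cost N M f g (\<lambda>i\<in>{1..N}. X i \<omega>) < rand_cost N M f g \<mu> + T + \<epsilon>}"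
    using N finite_support support_subset indep distr event
    by (intro P.prob_Pi_pmf_le[where R = "\<lambda>x. J_cost N M f g x < rand_cost N M f g \<mu> + T + \<epsilon>"]) auto
  finally show ?thesis .
qed

end

section \<open>The two deviation bounds\<close>

theorem theorem2p10:
  fixes N M :: nat
    and \<X> :: "nat \<Rightarrow> 'a set"
    and E :: "nat \<Rightarrow> 'e::{real_inner, banach, second_countable_topology} set"
    and f :: "nat \<Rightarrow> 'e \<Rightarrow> real"
    and g :: "nat \<Rightarrow> nat \<Rightarrow> 'a \<Rightarrow> 'e"
    and L L' :: "nat \<Rightarrow> real"
    and \<mu> :: "nat \<Rightarrow> 'a pmf"
    and P :: "'w measure"
    and X :: "nat \<Rightarrow> 'w \<Rightarrow> 'a"
  assumes "N \<ge> 1" and "M \<ge> 1"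
    and "\<And>i. i \<in> {1..N} \<Longrightarrow> \<X> i \<noteq> {}"
    and "\<And>j. j \<in> {1..M} \<Longrightarrow> subspace (E j) \<and> closed (E j)"
    and "\<And>i j. i \<in> {1..N} \<Longrightarrow> j \<in> {1..M} \<Longrightarrow> g i j \<in> \<X> i \<rightarrow> E j"
    and "cost_regularity N M \<X> E f g L L'"
    and "C0_const N M \<X> g L > 0"
    and "C1_const N M \<X> g L' > 0"
    and "\<And>i. i \<in> {1..N} \<Longrightarrow> \<mu> i \<in> finsupp_pmfs (\<X> i)"
    and "prob_space P"
    and "prob_space.indep_vars P (\<lambda>i. count_space (\<X> i)) X {1..N}"
    and "\<And>i. i \<in> {1..N} \<Longrightarrow> distr P (count_space UNIV) (X i) = measure_pmf (\<mu> i)"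
  shows "(\<forall>\<epsilon>>0.
            measure P {\<omega> \<in> space P. J_cost N M f g (\<lambda>i\<in>{1..N}. X i \<omega>)
                < rand_cost N M f g \<mu> + C1_const N M \<X> g L' / (2 * real N) + \<epsilon>}
              \<ge> 1 - exp (- (2 * real N * \<epsilon>\<^sup>2 / (C0_const N M \<X> g L)\<^sup>2)))
       \<and> (\<forall>v :: nat \<Rightarrow> real.
            (\<forall>i\<in>{1..N}. \<forall>x \<in> Pi\<^sub>E ({1..N} - {i}) \<X>.
               pmf_var (\<mu> i) (\<lambda>z. J_cost N M f g (x(i := z))) \<le> (v i)\<^sup>2) \<longrightarrow>
            (\<forall>\<epsilon>>0.
              measure P {\<omega> \<in> space P. J_cost N M f g (\<lambda>i\<in>{1..N}. X i \<omega>)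
                  < rand_cost N M f g \<mu>
                    + (\<Sum>j=1..M. \<Sum>i=1..N. L' j / (2 * (real N)\<^sup>2) * pmf_var (\<mu> i) (g i j)) + \<epsilon>}
                \<ge> 1 - exp (- (real N * \<epsilon>\<^sup>2
                    / (2 * ((\<Sum>i=1..N. real N * (v i)\<^sup>2) + C0_const N M \<X> g L * \<epsilon> / 3))))))"
proof (intro conjI allI impI)
  interpret randomized_cost N M \<X> E f g L L' \<mu>
    using assms by unfold_locales
  let ?C0 = "C0_const N M \<X> g L"
  have C0: "?C0 / N > 0" using assms by simp
  {
    fix \<epsilon> :: real assume "\<epsilon> > 0"
    \<comment> \<open>McDiarmid with \<open>N\<close> coordinates of oscillation
      \<open>?C0 / N\<close>: the denominator is \<open>N * (?C0 / N)\<^sup>2\<close>, that is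
      \<open>?C0\<^sup>2 / N\<close>.\<close>
    have "measure_pmf.prob product_pmf
        {x. J_cost N M f g x < measure_pmf.expectation product_pmf (J_cost N M f g) + \<epsilon>}
        \<ge> 1 - exp (- (2 * \<epsilon>\<^sup>2 / (card {1..N} * (?C0 / N)\<^sup>2)))"
      using N C0 \<open>\<epsilon> > 0\<close> by (intro mcdiarmid_Pi_pmf oscillation_J_cost finite_support) auto
    also have "2 * \<epsilon>\<^sup>2 / (card {1..N} * (?C0 / N)\<^sup>2) = 2 * real N * \<epsilon>\<^sup>2 / ?C0\<^sup>2"
      using N by (simp add: power_divide power2_eq_square)
    finally show "measure P {\<omega> \<in> space P. J_cost N M f g (\<lambda>i\<in>{1..N}. X i \<omega>)
                < rand_cost N M f g \<mu> + C1_const N M \<X> g L' / (2 * real N) + \<epsilon>}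
              \<ge> 1 - exp (- (2 * real N * \<epsilon>\<^sup>2 / ?C0\<^sup>2))"
      by (intro prob_J_cost_ge[OF assms(10-12)] variance_term_le_C1)
  }
  fix v :: "nat \<Rightarrow> real" and \<epsilon> :: real
  assume v: "\<forall>i\<in>{1..N}. \<forall>x \<in> Pi\<^sub>E ({1..N} - {i}) \<X>.
      pmf_var (\<mu> i) (\<lambda>z. J_cost N M f g (x(i := z))) \<le> (v i)\<^sup>2" and "\<epsilon> > 0"
  have var: "measure_pmf.variance (\<mu> i) (\<lambda>z. J_cost N M f g (x(i := z))) \<le> (v i)\<^sup>2"
    if i: "i \<in> {1..N}" and x: "x \<in> PiE_dflt ({1..N} - {i}) undefined (set_pmf \<circ> \<mu>)" for i x
  proof -
    \<comment> \<open>Points with default \<open>undefined\<close> are extensional and the supports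
      lie in the strategy sets, so the hypothesis on \<open>v\<close> applies to every
      \<open>x\<close> that Bernstein's bound requires.\<close>
    have "x \<in> Pi\<^sub>E ({1..N} - {i}) \<X>"
      using x support_subset by (fastforce simp: PiE_dflt_def PiE_def extensional_def)
    with v i show ?thesis by (simp add: pmf_var_real[OF finite_support[OF i], symmetric])
  qed
  have "measure_pmf.prob product_pmf
      {x. J_cost N M f g x < measure_pmf.expectation product_pmf (J_cost N M f g) + \<epsilon>}
      \<ge> 1 - exp (- (\<epsilon>\<^sup>2 / (2 * ((\<Sum>i=1..N. (v i)\<^sup>2) + ?C0 / N * \<epsilon> / 3))))"
    using C0 \<open>\<epsilon> > 0\<close> by (intro bernstein_Pi_pmf oscillation_J_cost finite_support var) auto
  \<comment> \<open>Extracting \<open>1 / N\<close> from the denominator produces both the factor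
    \<open>N\<close> on each squared \<open>v i\<close> and the factor \<open>N\<close> in the
    numerator of the exponent.\<close>
  also have "(\<Sum>i=1..N. (v i)\<^sup>2) + ?C0 / N * \<epsilon> / 3
      = ((\<Sum>i=1..N. real N * (v i)\<^sup>2) + ?C0 * \<epsilon> / 3) / N"
    using N by (simp add: sum_distrib_left[symmetric] add_divide_distrib)
  also have "\<epsilon>\<^sup>2 / (2 * (((\<Sum>i=1..N. real N * (v i)\<^sup>2) + ?C0 * \<epsilon> / 3) / N))
      = real N * \<epsilon>\<^sup>2 / (2 * ((\<Sum>i=1..N. real N * (v i)\<^sup>2) + ?C0 * \<epsilon> / 3))"
    by simp
  finally show "measure P {\<omega> \<in> space P. J_cost N M f g (\<lambda>i\<in>{1..N}. X i \<omega>)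
                  < rand_cost N M f g \<mu>
                    + (\<Sum>j=1..M. \<Sum>i=1..N. L' j / (2 * (real N)\<^sup>2) * pmf_var (\<mu> i) (g i j)) + \<epsilon>}
                \<ge> 1 - exp (- (real N * \<epsilon>\<^sup>2
                    / (2 * ((\<Sum>i=1..N. real N * (v i)\<^sup>2) + ?C0 * \<epsilon> / 3))))"
    by (intro prob_J_cost_ge[OF assms(10-12)] order_refl)
qed

end
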